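(* Let $\Omega$ be a finite set of items, let $m\ge 1$ and $k\ge 0$ be integers, and let $f_1,\dots,f_m:2^\Omega\to\mathbb{R}_{\ge 0}$ be monotone submodular functions. Let $(S_1,S_2)$ be the output of the Enumeration-based Algorithm run with a subroutine of approximation factor $\alpha=1-1/e$. Then $(S_1,S_2)$ is a $(1-1/e)$-approximate solution of problem P.0, i.e. $|S_1|\le k$, $|S_2|\le k$ and $$\sum_{i\in[m]}\max\{f_i(S_1),f_i(S_2)\}\ \ge\ (1-1/e)\,OPT_0 .$$
   Context: $[m]=\{1,\dots,m\}$. A function $f:2^\Omega\to\mathbb{R}_{\ge0}$ is submodular if $f(A\cup\{x\})-f(A)\ge f(A'\cup\{x\})-f(A')$ for all $A\subseteq A'\subseteq\Omega$ and $x\in\Omega\setminus A'$; it is monotone if $f(A)\le f(A')$ whenever $A\subseteq A'$. Problem P.0: maximize $\sum_{i\in[m]}\max\{f_i(S_1),f_i(S_2)\}$ over $S_1,S_2\subseteq\Omega$ with $|S_1|\le k$, $|S_2|\le k$. Its optimal value is $OPT_0$. Subroutine of approximation factor $\alpha$: a procedure which, for any $A\subseteq[m]$, returns a set $C\subseteq\Omega$ with $|C|\le k$ and $\sum_{i\in A}f_i(C)\ge\alpha\max_{S\subseteq\Omega,|S|\le k}\sum_{i\in A}f_i(S)$. Enumeration-based Algorithm: start with $S_1=S_2=\emptyset$. For every $A\subseteq[m]$: let $B=[m]\setminus A$; let $C_1$ and $C_2$ be the sets returned by the subroutine for $A$ and for $B$ respectively; if $\sum_{i\in[m]}\max\{f_i(C_1),f_i(C_2)\}\ge\sum_{i\in[m]}\max\{f_i(S_1),f_i(S_2)\}$,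 set $(S_1,S_2)\leftarrow(C_1,C_2)$. Return $(S_1,S_2)$. *)

theory Defs
  imports Complex_Main
begin

(* Set functions on 2^Omega are HOL functions on all sets of type 'a set; every notion below
   looks only at their values on subsets of Omega. *)

definition nonneg_on :: "'a set \<Rightarrow> ('a set \<Rightarrow> real) \<Rightarrow> bool" where
  "nonneg_on \<Omega> f \<longleftrightarrow> (\<forall>A. A \<subseteq> \<Omega> \<longrightarrow> 0 \<le> f A)"

definition submodular_on :: "'a set \<Rightarrow> ('a set \<Rightarrow> real) \<Rightarrow> bool" where
  "submodular_on \<Omega> f \<longleftrightarrow>
     (\<forall>A A' x. A \<subseteq> A' \<longrightarrow> A' \<subseteq> \<Omega> \<longrightarrow> x \<in> \<Omega> - A' \<longrightarrow>
        f (A \<union> {x}) - f A \<ge> f (A' \<union> {x}) - f A')"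

definition monotone_set_fun_on :: "'a set \<Rightarrow> ('a set \<Rightarrow> real) \<Rightarrow> bool" where
  "monotone_set_fun_on \<Omega> f \<longleftrightarrow> (\<forall>A A'. A \<subseteq> A' \<longrightarrow> A' \<subseteq> \<Omega> \<longrightarrow> f A \<le> f A')"

definition feasible_sets :: "'a set \<Rightarrow> nat \<Rightarrow> 'a set set" where
  "feasible_sets \<Omega> k = {S. S \<subseteq> \<Omega> \<and> card S \<le> k}"

definition objective0 :: "nat \<Rightarrow> (nat \<Rightarrow> 'a set \<Rightarrow> real) \<Rightarrow> 'a set \<times> 'a set \<Rightarrow> real" where
  "objective0 m f P = (\<Sum>i\<in>{1..m}. max (f i (fst P)) (f i (snd P)))"

(* For finite Omega the set of feasible pairs is finite and nonempty, so Max is the maximum. *)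
definition OPT0 :: "'a set \<Rightarrow> nat \<Rightarrow> nat \<Rightarrow> (nat \<Rightarrow> 'a set \<Rightarrow> real) \<Rightarrow> real" where
  "OPT0 \<Omega> k m f = Max (objective0 m f ` (feasible_sets \<Omega> k \<times> feasible_sets \<Omega> k))"

definition approx_solution0 ::
  "real \<Rightarrow> 'a set \<Rightarrow> nat \<Rightarrow> nat \<Rightarrow> (nat \<Rightarrow> 'a set \<Rightarrow> real) \<Rightarrow> 'a set \<times> 'a set \<Rightarrow> bool" where
  "approx_solution0 \<alpha> \<Omega> k m f P \<longleftrightarrow>
     fst P \<in> feasible_sets \<Omega> k \<and> snd P \<in> feasible_sets \<Omega> k \<and>
     objective0 m f P \<ge> \<alpha> * OPT0 \<Omega> k m f"

definition approx_subroutine ::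
  "real \<Rightarrow> 'a set \<Rightarrow> nat \<Rightarrow> nat \<Rightarrow> (nat \<Rightarrow> 'a set \<Rightarrow> real) \<Rightarrow> (nat set \<Rightarrow> 'a set) \<Rightarrow> bool" where
  "approx_subroutine \<alpha> \<Omega> k m f sub \<longleftrightarrow>
     (\<forall>A. A \<subseteq> {1..m} \<longrightarrow>
        sub A \<in> feasible_sets \<Omega> k \<and>
        (\<Sum>i\<in>A. f i (sub A)) \<ge> \<alpha> * Max ((\<lambda>S. \<Sum>i\<in>A. f i S) ` feasible_sets \<Omega> k))"

definition enum_step ::
  "nat \<Rightarrow> (nat \<Rightarrow> 'a set \<Rightarrow> real) \<Rightarrow> (nat set \<Rightarrow> 'a set) \<Rightarrow> nat set \<Rightarrow>
     'a set \<times> 'a set \<Rightarrow> 'a set \<times> 'a set" where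
  "enum_step m f sub A P =
     (let B = {1..m} - A; C = (sub A, sub B)
      in if objective0 m f C \<ge> objective0 m f P then C else P)"

(* The list is the order in which the loop visits the subsets A of [m]. *)
definition enum_algorithm ::
  "nat \<Rightarrow> (nat \<Rightarrow> 'a set \<Rightarrow> real) \<Rightarrow> (nat set \<Rightarrow> 'a set) \<Rightarrow> nat set list \<Rightarrow> 'a set \<times> 'a set" where
  "enum_algorithm m f sub As = fold (enum_step m f sub) As ({}, {})"

end

(* If (O1, O2) is an optimal pair and A is the set of indices i with f_i(O1) >= f_i(O2), then
   OPT_0 splits as the sum of f_i(O1) over A plus the sum of f_i(O2) over the complement of A,
   and the subroutine is alpha-optimal on each part. The loop visits A, and the objective never
   decreases during the loop. *)
theory Submission
  imports Defs
begin

lemma finite_feasible_sets: "finite \<Omega> \<Longrightarrow> finite (feasible_sets \<Omega> k)"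
  unfolding feasible_sets_def by simp

lemma empty_feasible: "{} \<in> feasible_sets \<Omega> k"
  unfolding feasible_sets_def by simp

text \<open>A step replaces the current pair only by a candidate that is at least as good, so the
  loop never loses value.\<close>

lemma objective0_fold_enum_step_mono:
  "objective0 m f P \<le> objective0 m f (fold (enum_step m f sub) As P)"
proof (induction As arbitrary: P)
  case (Cons A As)
  have "objective0 m f P \<le> objective0 m f (enum_step m f sub A P)"
    by (simp add: enum_step_def Let_def)
  also have "\<dots> \<le> objective0 m f (fold (enum_step m f sub) As (enum_step m f sub A P))"
    by (rule Cons.IH)
  finally show ?case by simp
qed simp

text \<open>When the loop reaches \<open>A\<close>, the pair it keeps is at least as good as the
  candidate for \<open>A\<close>, and monotonicity of the remaining steps preserves this
  bound.\<close>

lemma objective0_fold_enum_step_ge: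
  assumes "A \<in> set As"
  shows "objective0 m f (sub A, sub ({1..m} - A)) \<le> objective0 m f (fold (enum_step m f sub) As P)"
  using assms
proof (induction As arbitrary: P)
  case (Cons A' As)
  show ?case
  proof (cases "A = A'")
    case True
    have "objective0 m f (sub A, sub ({1..m} - A)) \<le> objective0 m f (enum_step m f sub A P)"
      by (simp add: enum_step_def Let_def)
    also have "\<dots> \<le> objective0 m f (fold (enum_step m f sub) As (enum_step m f sub A P))"
      by (rule objective0_fold_enum_step_mono)
    finally show ?thesis using True by simp
  next
    \<comment> \<open>\<open>A\<close> lies in the tail. The induction hypothesis is used at the
      pair already updated by \<open>A'\<close>, which is why \<open>P\<close> is
      generalized.\<close>
    case False
    then show ?thesis using Cons by simp
  qed
qed simp

text \<open>Feasibility is a loop invariant: a step keeps \<open>P\<close> or takes two subroutine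
  outputs, whose arguments \<open>A\<close> and its complement are both subsets of [m].\<close>

lemma fold_enum_step_feasible:
  assumes "approx_subroutine \<alpha> \<Omega> k m f sub" and "set As \<subseteq> Pow {1..m}"
    and "P \<in> feasible_sets \<Omega> k \<times> feasible_sets \<Omega> k"
  shows "fold (enum_step m f sub) As P \<in> feasible_sets \<Omega> k \<times> feasible_sets \<Omega> k"
  using assms(2,3)
proof (induction As arbitrary: P)
  case (Cons A As)
  have "sub A \<in> feasible_sets \<Omega> k" "sub ({1..m} - A) \<in> feasible_sets \<Omega> k"
    using assms(1) Cons.prems(1) by (auto simp: approx_subroutine_def)
  then have "enum_step m f sub A P \<in> feasible_sets \<Omega> k \<times> feasible_sets \<Omega> k"
    using Cons.prems(2) by (simp add: enum_step_def Let_def)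
  then show ?case using Cons by simp
qed simp

text \<open>Trades the maximum in the guarantee for an arbitrary feasible competitor
  \<open>S\<close>, so that the two halves of an optimal pair can be plugged in separately.\<close>

lemma approx_subroutineD:
  assumes "approx_subroutine \<alpha> \<Omega> k m f sub" and "finite \<Omega>" and "0 \<le> \<alpha>"
    and "A \<subseteq> {1..m}" and "S \<in> feasible_sets \<Omega> k"
  shows "\<alpha> * (\<Sum>i\<in>A. f i S) \<le> (\<Sum>i\<in>A. f i (sub A))"
proof -
  have "(\<Sum>i\<in>A. f i S) \<le> Max ((\<lambda>S. \<Sum>i\<in>A. f i S) ` feasible_sets \<Omega> k)"
    using assms(2,5) by (intro Max_ge) (auto simp: finite_feasible_sets)
  then have "\<alpha> * (\<Sum>i\<in>A. f i S) \<le> \<alpha> * Max ((\<lambda>S. \<Sum>i\<in>A. f i S) ` feasible_sets \<Omega> k)"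
    using assms(3) by (rule mult_left_mono)
  also have "\<dots> \<le> (\<Sum>i\<in>A. f i (sub A))"
    using assms(1,4) by (simp add: approx_subroutine_def)
  finally show ?thesis .
qed

lemma enum_algorithm_approx_solution0:
  assumes "finite \<Omega>" and "0 \<le> \<alpha>"
    and sub: "approx_subroutine \<alpha> \<Omega> k m f sub" and As: "set As = Pow {1..m}"
  shows "approx_solution0 \<alpha> \<Omega> k m f (enum_algorithm m f sub As)"
proof -
  let ?F = "feasible_sets \<Omega> k"
  \<comment> \<open>The maximum is attained: there are finitely many feasible pairs, and
    \<open>({}, {})\<close> is one of them.\<close>
  have "OPT0 \<Omega> k m f \<in> objective0 m f ` (?F \<times> ?F)"
    unfolding OPT0_def using assms(1) empty_feasible
    by (intro Max_in) (auto simp: finite_feasible_sets)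
  then obtain O1 O2 where O: "O1 \<in> ?F" "O2 \<in> ?F"
    and opt: "OPT0 \<Omega> k m f = objective0 m f (O1, O2)"
    by auto
  \<comment> \<open>Ties go to \<open>A\<close>; on either side of the partition the max reduces to
    a single term.\<close>
  define A where "A = {i \<in> {1..m}. f i O2 \<le> f i O1}"
  define B where "B = {1..m} - A"
  have AB: "A \<subseteq> {1..m}" "B \<subseteq> {1..m}"
    by (auto simp: A_def B_def)
  have split: "sum g {1..m} = sum g A + sum g B" for g :: "nat \<Rightarrow> real"
    unfolding B_def using AB(1) by (simp add: sum.subset_diff)
  have "OPT0 \<Omega> k m f = (\<Sum>i\<in>A. max (f i O1) (f i O2)) + (\<Sum>i\<in>B. max (f i O1) (f i O2))"
    by (simp only: opt objective0_def split fst_conv snd_conv)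
  also have "(\<Sum>i\<in>A. max (f i O1) (f i O2)) = (\<Sum>i\<in>A. f i O1)"
    by (intro sum.cong) (auto simp: A_def)
  also have "(\<Sum>i\<in>B. max (f i O1) (f i O2)) = (\<Sum>i\<in>B. f i O2)"
    by (intro sum.cong) (auto simp: A_def B_def)
  finally have "\<alpha> * OPT0 \<Omega> k m f = \<alpha> * (\<Sum>i\<in>A. f i O1) + \<alpha> * (\<Sum>i\<in>B. f i O2)"
    by (simp add: distrib_left)
  \<comment> \<open>The competitor is \<open>O1\<close> for the indices in \<open>A\<close> and
    \<open>O2\<close> for those in \<open>B\<close>.\<close>
  also have "\<dots> \<le> (\<Sum>i\<in>A. f i (sub A)) + (\<Sum>i\<in>B. f i (sub B))"
    using O AB assms by (intro add_mono approx_subroutineD)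
  \<comment> \<open>The objective lets each index choose its better set, so fixing the choice by the
    partition can only underestimate it.\<close>
  also have "\<dots> \<le> (\<Sum>i\<in>A. max (f i (sub A)) (f i (sub B)))
      + (\<Sum>i\<in>B. max (f i (sub A)) (f i (sub B)))"
    by (intro add_mono sum_mono) auto
  also have "\<dots> = objective0 m f (sub A, sub B)"
    by (simp only: objective0_def split fst_conv snd_conv)
  also have "\<dots> \<le> objective0 m f (enum_algorithm m f sub As)"
    unfolding enum_algorithm_def B_def using AB(1) As
    by (intro objective0_fold_enum_step_ge) simp
  finally have "\<alpha> * OPT0 \<Omega> k m f \<le> objective0 m f (enum_algorithm m f sub As)" .
  moreover have "enum_algorithm m f sub As \<in> ?F \<times> ?F"
    unfolding enum_algorithm_def using As
    by (intro fold_enum_step_feasible[OF sub]) (simp_all add: empty_feasible)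
  ultimately show ?thesis
    by (auto simp: approx_solution0_def mem_Times_iff)
qed

theorem theorem1:
  fixes \<Omega> :: "'a set" and m k :: nat
    and f :: "nat \<Rightarrow> 'a set \<Rightarrow> real"
    and sub :: "nat set \<Rightarrow> 'a set"
    and As :: "nat set list"
    and S1 S2 :: "'a set"
  assumes "finite \<Omega>" and "m \<ge> 1"
    and "\<And>i. i \<in> {1..m} \<Longrightarrow> nonneg_on \<Omega> (f i)"
    and "\<And>i. i \<in> {1..m} \<Longrightarrow> monotone_set_fun_on \<Omega> (f i)"
    and "\<And>i. i \<in> {1..m} \<Longrightarrow> submodular_on \<Omega> (f i)"
    and "approx_subroutine (1 - 1 / exp 1) \<Omega> k m f sub"
    and "distinct As" and "set As = Pow {1..m}"
    and "(S1, S2) = enum_algorithm m f sub As"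
  shows "approx_solution0 (1 - 1 / exp 1) \<Omega> k m f (S1, S2)"
  unfolding assms(9)
  \<comment> \<open>The side condition on the factor, 0 \<le> 1 - 1/e, holds because e \<ge>
    1.\<close>
  using assms(1,6,8) by (intro enum_algorithm_approx_solution0) simp_all

end
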